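(* Let $n,k,m\in\mathbb N$, let $R=[r_1\dots r_k]^T$ with $r_i\in\mathbb N$, $\Lambda=[\lambda_1\dots\lambda_m]^T$ with $\lambda_i\in\mathbb N$, and $H=[h_1\dots h_m]^T$ with $h_1,\dots,h_m\in\{1,\dots,n\}$ distinct; let $J_k=[1\dots1]^T$ ($k$ entries). Then $\Lambda K_n^H$ is almost $R$-factorizable if and only if $\sum_{i=1}^k r_i-k\le\sum_{i=1}^m\lambda_i\binom{n-1}{h_i-1}\le\sum_{i=1}^k r_i$ and there exists a non-negative integer matrix $A=[a_{ij}]_{k\times m}$ such that $n(R-J_k)\le AH\le nR$ componentwise and $\sum_{i=1}^k a_{ij}=\lambda_j\binom{n}{h_j}$ for $1\le j\le m$.
   Context: $\Lambda K_n^H$ is the hypergraph on $n$ vertices in which, for each $1\le i\le m$ and each set of $h_i$ distinct vertices, there are exactly $\lambda_i$ edges of size $h_i$ joining exactly those vertices (one hinge per vertex). A $(q,r)$-factor is a spanning sub-hypergraph in which every vertex $v$ has $q\le d(v)\le r$. An almost $R$-factorization is a partition $\{F_1,\dots,F_k\}$ of the edge set such that $F_i$ is an $(r_i-1,r_i)$-factor for $1\le i\le k$. *)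

theory Defs imports Complex_Main "HOL-Library.Disjoint_Sets" begin

text \<open>
  Hypergraphs with repeated edges, given by hinges: every hinge \<open>x\<close> attaches its edge
  \<open>hinge_edge x\<close> to its vertex \<open>hinge_vert x\<close>. An edge thus carries a multiset of vertices,
  and the degree of a vertex counts hinges.
\<close>

record ('v, 'e, 'x) hypergraph =
  verts :: "'v set"
  edges :: "'e set"
  hinges :: "'x set"
  hinge_vert :: "'x \<Rightarrow> 'v"
  hinge_edge :: "'x \<Rightarrow> 'e"

definition is_hypergraph :: "('v, 'e, 'x) hypergraph \<Rightarrow> bool" where
  "is_hypergraph G \<longleftrightarrow>
     finite (verts G) \<and> finite (edges G) \<and> finite (hinges G) \<and>
     hinge_vert G ` hinges G \<subseteq> verts G \<and> hinge_edge G ` hinges G = edges G"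

definition hdegree :: "('v, 'e, 'x) hypergraph \<Rightarrow> 'v \<Rightarrow> nat" where
  "hdegree G v = card {x \<in> hinges G. hinge_vert G x = v}"

definition spanning_sub :: "('v, 'e, 'x) hypergraph \<Rightarrow> 'e set \<Rightarrow> ('v, 'e, 'x) hypergraph" where
  "spanning_sub G F = G\<lparr>edges := F, hinges := {x \<in> hinges G. hinge_edge G x \<in> F}\<rparr>"

text \<open>
  A spanning sub-hypergraph is identified with its edge set. The bounds are integers because
  \<open>q\<close> will be \<open>r\<^sub>i - 1\<close>, which must not be truncated.
\<close>

definition is_factor :: "('v, 'e, 'x) hypergraph \<Rightarrow> int \<Rightarrow> int \<Rightarrow> 'e set \<Rightarrow> bool" where
  "is_factor G q r F \<longleftrightarrow> F \<subseteq> edges G \<and>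
     (\<forall>v\<in>verts G. q \<le> int (hdegree (spanning_sub G F) v) \<and> int (hdegree (spanning_sub G F) v) \<le> r)"

text \<open>
  The factors form an indexed partition of the edges. A factor may have no edges (this is
  possible only if \<open>r\<^sub>i \<le> 1\<close> or there are no vertices).
\<close>

definition almost_factorizable :: "('v, 'e, 'x) hypergraph \<Rightarrow> nat \<Rightarrow> (nat \<Rightarrow> nat) \<Rightarrow> bool" where
  "almost_factorizable G k r \<longleftrightarrow>
     (\<exists>F :: nat \<Rightarrow> 'e set.
        (\<Union>i\<in>{1..k}. F i) = edges G \<and> disjoint_family_on F {1..k} \<and>
        (\<forall>i\<in>{1..k}. is_factor G (int (r i) - 1) (int (r i)) (F i)))"

text \<open>
  The edge \<open>(i, S, c)\<close> is the \<open>c\<close>-th of the \<open>lam i\<close> parallel edges of size \<open>h i\<close> on the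
  vertex set \<open>S\<close>; the hinge \<open>(e, v)\<close> attaches \<open>e\<close> to \<open>v\<close>.
\<close>

definition LK_edges :: "nat \<Rightarrow> nat \<Rightarrow> (nat \<Rightarrow> nat) \<Rightarrow> (nat \<Rightarrow> nat) \<Rightarrow> (nat \<times> nat set \<times> nat) set" where
  "LK_edges n m lam h =
     {(i, S, c). i \<in> {1..m} \<and> S \<subseteq> {1..n} \<and> card S = h i \<and> c \<in> {1..lam i}}"

definition LK :: "nat \<Rightarrow> nat \<Rightarrow> (nat \<Rightarrow> nat) \<Rightarrow> (nat \<Rightarrow> nat) \<Rightarrow>
    (nat, nat \<times> nat set \<times> nat, (nat \<times> nat set \<times> nat) \<times> nat) hypergraph" where
  "LK n m lam h =
     \<lparr>verts = {1..n},
      edges = LK_edges n m lam h,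
      hinges = {(e, v). e \<in> LK_edges n m lam h \<and> v \<in> fst (snd e)},
      hinge_vert = snd,
      hinge_edge = fst\<rparr>"

lemma finite_LK_edges: "finite (LK_edges n m lam h)"
proof (rule finite_subset)
  show "LK_edges n m lam h \<subseteq> Sigma {1..m} (\<lambda>i. Pow {1..n} \<times> {1..lam i})"
    by (auto simp: LK_edges_def)
qed auto

lemma is_hypergraph_LK:
  assumes "h ` {1..m} \<subseteq> {1..n}"
  shows "is_hypergraph (LK n m lam h)"
proof -
  have "hinges (LK n m lam h) \<subseteq> LK_edges n m lam h \<times> {1..n}"
    by (auto simp: LK_def LK_edges_def)
  then have "finite (hinges (LK n m lam h))"
    by (rule finite_subset) (simp add: finite_LK_edges)
  moreover have "e \<in> fst ` hinges (LK n m lam h)" if e: "e \<in> LK_edges n m lam h" for e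
  proof -
    obtain i S c where [simp]: "e = (i, S, c)" by (cases e)
    have "i \<in> {1..m}" "card S = h i" using e by (auto simp: LK_edges_def)
    moreover from this have "h i \<in> {1..n}" using assms by blast
    ultimately have "card S \<noteq> 0" by simp
    then obtain v where "v \<in> S" by fastforce
    then have "(e, v) \<in> hinges (LK n m lam h)" using e by (simp add: LK_def)
    then show ?thesis by force
  qed
  ultimately show ?thesis
    by (auto simp: is_hypergraph_def LK_def finite_LK_edges) (auto simp: LK_edges_def)
qed

lemma LK_multiplicity:
  assumes "inj_on h {1..m}" "i \<in> {1..m}" "S \<subseteq> {1..n}" "card S = h i"
  shows "card {e \<in> edges (LK n m lam h).
           bij_betw (hinge_vert (LK n m lam h))
             {x \<in> hinges (LK n m lam h). hinge_edge (LK n m lam h) x = e} S} = lam i"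
proof -
  have *: "bij_betw snd {x. x \<in> {(e, v). e \<in> LK_edges n m lam h \<and> v \<in> fst (snd e)} \<and> fst x = e} S
        \<longleftrightarrow> fst (snd e) = S" if "e \<in> LK_edges n m lam h" for e
  proof -
    have eq: "{x. x \<in> {(e, v). e \<in> LK_edges n m lam h \<and> v \<in> fst (snd e)} \<and> fst x = e}
        = Pair e ` fst (snd e)" using that by (auto simp: image_iff)
    have "inj_on snd (Pair e ` fst (snd e))" by (rule inj_onI) auto
    then show ?thesis unfolding eq bij_betw_def image_image by simp
  qed
  have "{e \<in> LK_edges n m lam h. fst (snd e) = S} = (\<lambda>c. (i, S, c)) ` {1..lam i}"
  proof (intro equalityI subsetI)
    fix e assume "e \<in> {e \<in> LK_edges n m lam h. fst (snd e) = S}"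
    then obtain i' c where e: "e = (i', S, c)" "i' \<in> {1..m}" "card S = h i'" "c \<in> {1..lam i'}"
      by (auto simp: LK_edges_def)
    with assms have "i' = i" by (metis inj_onD)
    with e show "e \<in> (\<lambda>c. (i, S, c)) ` {1..lam i}" by blast
  next
    fix e assume "e \<in> (\<lambda>c. (i, S, c)) ` {1..lam i}"
    then show "e \<in> {e \<in> LK_edges n m lam h. fst (snd e) = S}"
      using assms(2-4) by (auto simp: LK_edges_def)
  qed
  moreover have "card \<dots> = lam i"
    by (subst card_image) (auto simp: inj_on_def)
  moreover have "{e \<in> edges (LK n m lam h).
           bij_betw (hinge_vert (LK n m lam h))
             {x \<in> hinges (LK n m lam h). hinge_edge (LK n m lam h) x = e} S}
      = {e \<in> LK_edges n m lam h. fst (snd e) = S}"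
    unfolding LK_def hypergraph.simps using * by (intro Collect_cong conj_cong refl)
  ultimately show ?thesis by metis
qed

end

theory Submission imports Defs begin

text \<open>
  Necessity is a count of hinges by edge type and factor. For sufficiency, the edges start with
  prescribed sizes and factors (the matrix \<open>A\<close>) but no vertices, and the vertices are attached one
  at a time, as in Baranyai's theorem. When \<open>N\<close> vertices remain, an edge which still lacks \<open>g\<close>
  vertices would ideally receive a fraction \<open>g / N\<close> of the next one. This fractional assignment
  forms a matrix (factors against edge descriptions) whose column sums are integers, and it is
  rounded so that all entries and all row sums change by less than 1 and the column sums are kept.
  Rounding keeps each degree in \<open>[r\<^sub>i - 1, r\<^sub>i]\<close> and the invariant that the remaining hinges of the
  \<open>i\<close>-th factor average to \<open>[r\<^sub>i - 1, r\<^sub>i]\<close> over the remaining vertices.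
\<close>

section \<open>Rounding of matrices\<close>

text \<open>Gaussian elimination: a pivot unknown \<open>g\<close> of the equation \<open>e\<close>
  is removed from the other equations, which leaves one equation and one unknown fewer. If
  \<open>e\<close> has no pivot, it holds for every \<open>z\<close>.\<close>

lemma underdetermined_nontrivial_solution:
  fixes a :: "'e \<Rightarrow> 'f \<Rightarrow> 'a::field"
  assumes "finite E" "finite F" "card E < card F"
  shows "\<exists>z. (\<exists>f\<in>F. z f \<noteq> 0) \<and> (\<forall>e\<in>E. (\<Sum>f\<in>F. a e f * z f) = 0)"
  using assms
proof (induction E arbitrary: F a rule: finite_induct)
  case empty
  then obtain f where "f \<in> F" by fastforce
  then show ?case by (intro exI[of _ "\<lambda>_. 1"]) auto
next
  case (insert e E)
  show ?case
  proof (cases "\<forall>f\<in>F. a e f = 0")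
    case True
    have "card E < card F" using insert by simp
    from insert.IH[OF insert.prems(1) this, of a] True show ?thesis by force
  next
    case False
    then obtain g where g: "g \<in> F" "a e g \<noteq> 0" by blast
    let ?F = "F - {g}"
    have "finite ?F" "card E < card ?F" using insert g by auto
    \<comment> \<open>These are the coefficients left after subtracting the multiple of equation
      \<open>e\<close> that cancels \<open>g\<close>.\<close>
    from insert.IH[OF this, of "\<lambda>e' f. a e' f - a e' g / a e g * a e f"]
    obtain z where z: "\<exists>f\<in>?F. z f \<noteq> 0"
      and zE: "\<And>e'. e' \<in> E \<Longrightarrow> (\<Sum>f\<in>?F. (a e' f - a e' g / a e g * a e f) * z f) = 0" by blast
    define s where "s = (\<Sum>f\<in>?F. a e f * z f)"
    \<comment> \<open>The value at \<open>g\<close> is the one that equation \<open>e\<close>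
      forces.\<close>
    define w where "w = z(g := - s / a e g)"
    have sum_w: "(\<Sum>f\<in>F. b f * w f) = (\<Sum>f\<in>?F. b f * z f) - b g * s / a e g" for b
    proof -
      have "(\<Sum>f\<in>F. b f * w f) = b g * w g + (\<Sum>f\<in>?F. b f * w f)"
        using insert.prems(1) g(1) by (rule sum.remove)
      also have "(\<Sum>f\<in>?F. b f * w f) = (\<Sum>f\<in>?F. b f * z f)"
        by (rule sum.cong) (auto simp: w_def)
      finally show ?thesis by (simp add: w_def)
    qed
    have "(\<Sum>f\<in>F. a e f * w f) = 0"
      using g(2) by (simp add: sum_w s_def)
    moreover have "(\<Sum>f\<in>F. a e' f * w f) = 0" if "e' \<in> E" for e'
    proof -
      have "(\<Sum>f\<in>?F. a e' f * z f) - a e' g / a e g * s = 0"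
        unfolding zE[OF that, symmetric] s_def
        by (simp add: sum_subtractf sum_distrib_left algebra_simps)
      then show ?thesis by (simp add: sum_w)
    qed
    moreover have "\<exists>f\<in>F. w f \<noteq> 0" using z by (auto simp: w_def)
    ultimately show ?thesis by blast
  qed
qed

text \<open>A lone nonintegral term would be the integral total minus a sum of integers.\<close>

lemma two_nonintegral_terms:
  fixes x :: "'a \<Rightarrow> real"
  assumes "finite P" "(\<Sum>p\<in>P. x p) \<in> \<int>" "p \<in> P" "x p \<notin> \<int>"
  shows "2 \<le> card {p\<in>P. x p \<notin> \<int>}"
proof (rule ccontr)
  assume "\<not> ?thesis"
  moreover have "p \<in> {p\<in>P. x p \<notin> \<int>}" "finite {p\<in>P. x p \<notin> \<int>}" using assms by auto
  ultimately have "card {p\<in>P. x p \<notin> \<int>} = 1"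
    by (metis (no_types, lifting) One_nat_def Suc_1 Suc_leI card_gt_0_iff empty_iff le_neq_implies_less not_le)
  then obtain u where u: "{p\<in>P. x p \<notin> \<int>} = {u}" by (rule card_1_singletonE)
  have only: "x q \<in> \<int>" if "q \<in> P - {p}" for q
  proof (rule ccontr)
    assume "x q \<notin> \<int>"
    with that assms(3,4) have "{p, q} \<subseteq> {u}" "p \<noteq> q" unfolding u[symmetric] by auto
    then show False by simp
  qed
  have "x p = (\<Sum>q\<in>P. x q) - (\<Sum>q\<in>P - {p}. x q)"
    using assms by (simp add: sum.remove)
  also have "\<dots> \<in> \<int>"
    by (rule Ints_diff[OF assms(2) Ints_sum[OF only]])
  finally show False using assms(4) by simp
qed

section \<open>Perturbations that preserve row and column sums\<close>

lemma two_card_le_of_fibres: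
  assumes "finite F" "\<And>i. i \<in> f ` F \<Longrightarrow> 2 \<le> card {p\<in>F. f p = i}"
  shows "2 * card (f ` F) \<le> card F"
proof -
  have "2 * card (f ` F) = (\<Sum>i\<in>f ` F. 2)" by simp
  also have "\<dots> \<le> (\<Sum>i\<in>f ` F. card {p\<in>F. f p = i})" using assms(2) by (rule sum_mono)
  also have "\<dots> = card F" using sum.image_gen[OF assms(1), of "\<lambda>_. 1 :: nat" f] by simp
  finally show ?thesis .
qed

text \<open>The cells of \<open>F\<close> are unknowns, and each row or column sum gives an
  equation. With two cells in every occupied row and column, rows and columns together number at
  most \<open>card F\<close>; dropping one equation leaves strictly more unknowns than equations. In
  the application, \<open>F\<close> consists of the nonintegral entries.\<close>

lemma matrix_null_direction:
  fixes F :: "('a \<times> 'b) set"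
  assumes F: "finite F" "F \<noteq> {}"
    and rows: "\<And>i. i \<in> fst ` F \<Longrightarrow> 2 \<le> card {f\<in>F. fst f = i}"
    and cols: "\<And>p. p \<in> snd ` F \<Longrightarrow> 2 \<le> card {f\<in>F. snd f = p}"
  shows "\<exists>z :: 'a \<times> 'b \<Rightarrow> real. (\<exists>f\<in>F. z f \<noteq> 0) \<and>
    (\<forall>i. (\<Sum>f\<in>{f\<in>F. fst f = i}. z f) = 0) \<and> (\<forall>p. (\<Sum>f\<in>{f\<in>F. snd f = p}. z f) = 0)"
proof -
  obtain i0 where i0: "i0 \<in> fst ` F" using F(2) by blast
  define a :: "'a + 'b \<Rightarrow> 'a \<times> 'b \<Rightarrow> real"
    where "a e f = (case e of Inl i \<Rightarrow> of_bool (fst f = i) | Inr p \<Rightarrow> of_bool (snd f = p))" for e f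
  \<comment> \<open>The equation of row \<open>i0\<close> is redundant: the row sums and the column sums have the same total.\<close>
  let ?E = "(fst ` F - {i0}) <+> snd ` F"
  have "card (fst ` F) > 0" using i0 F(1) by (auto simp: card_gt_0_iff)
  then have "card ?E < card (fst ` F) + card (snd ` F)"
    using F(1) i0 by (simp add: card_Plus)
  also have "\<dots> \<le> card F"
    using two_card_le_of_fibres[OF F(1) rows] two_card_le_of_fibres[OF F(1) cols] by linarith
  finally obtain z where z: "\<exists>f\<in>F. z f \<noteq> 0" and ze: "\<And>e. e \<in> ?E \<Longrightarrow> (\<Sum>f\<in>F. a e f * z f) = 0"
    using underdetermined_nontrivial_solution[of ?E F a] F(1) by auto
  have Inl: "(\<Sum>f\<in>F. a (Inl i) f * z f) = (\<Sum>f\<in>{f\<in>F. fst f = i}. z f)" for i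
    unfolding sum.inter_filter[OF F(1)] by (rule sum.cong) (auto simp: a_def)
  have Inr: "(\<Sum>f\<in>F. a (Inr p) f * z f) = (\<Sum>f\<in>{f\<in>F. snd f = p}. z f)" for p
    unfolding sum.inter_filter[OF F(1)] by (rule sum.cong) (auto simp: a_def)
  have c: "(\<Sum>f\<in>{f\<in>F. snd f = p}. z f) = 0" for p
  proof (cases "p \<in> snd ` F")
    case True
    then show ?thesis using ze[OF InrI] by (simp add: Inr)
  next
    case False
    then have e: "{f\<in>F. snd f = p} = {}" by force
    show ?thesis unfolding e by simp
  qed
  have r: "(\<Sum>f\<in>{f\<in>F. fst f = i}. z f) = 0" if "i \<noteq> i0" for i
  proof (cases "i \<in> fst ` F")
    case True
    then show ?thesis using ze[OF InlI] that by (simp add: Inl)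
  next
    case False
    then have e: "{f\<in>F. fst f = i} = {}" by force
    show ?thesis unfolding e by simp
  qed
  have "(\<Sum>f\<in>{f\<in>F. fst f = i0}. z f) = (\<Sum>i\<in>fst ` F. \<Sum>f\<in>{f\<in>F. fst f = i}. z f)"
    using F(1) i0 r by (subst sum.remove[of _ i0]) auto
  also have "\<dots> = (\<Sum>f\<in>F. z f)" using F(1) by (rule sum.image_gen[symmetric])
  also have "\<dots> = (\<Sum>p\<in>snd ` F. \<Sum>f\<in>{f\<in>F. snd f = p}. z f)" using F(1) by (rule sum.image_gen)
  finally have "(\<Sum>f\<in>{f\<in>F. fst f = i0}. z f) = 0" using c by simp
  with r have "(\<Sum>f\<in>{f\<in>F. fst f = i}. z f) = 0" for i by (cases "i = i0") auto
  with c z show ?thesis by (intro exI[of _ z]) simp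
qed

text \<open>All entries move linearly from \<open>x\<close> in direction \<open>z\<close> and stop
  when the first moving one reaches an integer; until then none leaves the interval between its
  floor and its ceiling.\<close>

lemma step_until_integral:
  fixes x z :: "'f \<Rightarrow> real"
  assumes F: "finite F" and frac: "\<And>f. f \<in> F \<Longrightarrow> x f \<notin> \<int>" and z: "\<exists>f\<in>F. z f \<noteq> 0"
  shows "\<exists>t. (\<exists>f\<in>F. x f + t * z f \<in> \<int>) \<and>
    (\<forall>f\<in>F. of_int \<lfloor>x f\<rfloor> \<le> x f + t * z f \<and> x f + t * z f \<le> of_int \<lceil>x f\<rceil>)"
proof -
  \<comment> \<open>\<open>b f\<close> is the integer that a moving entry heads for, and
    \<open>T f\<close> is the time of its arrival. Entries with \<open>z f = 0\<close> never move
    and are kept out of \<open>G\<close>.\<close>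
  define b where "b f = (if z f > 0 then of_int \<lceil>x f\<rceil> else of_int \<lfloor>x f\<rfloor> :: real)" for f
  define T where "T f = (b f - x f) / z f" for f
  define G where "G = {f\<in>F. z f \<noteq> 0}"
  define t where "t = Min (T ` G)"
  have G: "finite G" "G \<noteq> {}" using F z by (auto simp: G_def)
  have T0: "0 \<le> T f" if "f \<in> G" for f
    by (cases "z f > 0") (auto simp: T_def b_def divide_nonpos_nonpos)
  have "t \<in> T ` G" unfolding t_def using G by (intro Min_in) auto
  then obtain g where g: "g \<in> G" "t = T g" by blast
  have t0: "0 \<le> t" using g T0 by simp
  have tle: "t \<le> T f" if "f \<in> G" for f unfolding t_def using G that by simp
  have "x g + t * z g = b g" using g by (simp add: T_def G_def)
  then have "x g + t * z g \<in> \<int>" by (simp add: b_def)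
  moreover have "of_int \<lfloor>x f\<rfloor> \<le> x f + t * z f \<and> x f + t * z f \<le> of_int \<lceil>x f\<rceil>" if "f \<in> F" for f
  proof -
    consider "z f = 0" | "z f > 0" | "z f < 0" by linarith
    then show ?thesis
    proof cases
      case 1
      then show ?thesis by simp
    next
      case 2
      then have "t * z f \<le> b f - x f"
        using tle[of f] that by (simp add: G_def T_def pos_le_divide_eq)
      moreover have "0 \<le> t * z f" using 2 t0 by simp
      ultimately show ?thesis using 2 by (simp add: b_def) linarith
    next
      case 3
      then have "b f - x f \<le> t * z f"
        using tle[of f] that by (simp add: G_def T_def neg_le_divide_eq)
      moreover have "t * z f \<le> 0" using 3 t0 by (simp add: mult_nonneg_nonpos)
      ultimately show ?thesis using 3 by (simp add: b_def) linarith
    qed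
  qed
  ultimately show ?thesis using g(1) by (auto simp: G_def)
qed

text \<open>Induction on the number of nonintegral entries. As all row and column sums are integral,
  a row or column with one such entry has a second one, so a sum-preserving perturbation of these
  entries exists; following it until one of them becomes integral reduces their number.\<close>

lemma matrix_rounding_integral_sums:
  fixes x :: "'a \<times> 'b \<Rightarrow> real"
  assumes fin: "finite I" "finite P"
    and "\<And>i. i \<in> I \<Longrightarrow> (\<Sum>p\<in>P. x (i, p)) \<in> \<int>"
    and "\<And>p. p \<in> P \<Longrightarrow> (\<Sum>i\<in>I. x (i, p)) \<in> \<int>"
  shows "\<exists>y :: 'a \<times> 'b \<Rightarrow> int.
    (\<forall>f\<in>I \<times> P. \<lfloor>x f\<rfloor> \<le> y f \<and> y f \<le> \<lceil>x f\<rceil>) \<and>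
    (\<forall>i\<in>I. of_int (\<Sum>p\<in>P. y (i, p)) = (\<Sum>p\<in>P. x (i, p))) \<and>
    (\<forall>p\<in>P. of_int (\<Sum>i\<in>I. y (i, p)) = (\<Sum>i\<in>I. x (i, p)))"
  using assms(3,4)
proof (induction "card {f \<in> I \<times> P. x f \<notin> \<int>}" arbitrary: x rule: less_induct)
  case less
  define F where "F = {f \<in> I \<times> P. x f \<notin> \<int>}"
  have F: "finite F" "F \<subseteq> I \<times> P" using fin by (auto simp: F_def)
  show ?case
  proof (cases "F = {}")
    case True
    then have floor: "of_int \<lfloor>x f\<rfloor> = x f" if "f \<in> I \<times> P" for f
      using that by (auto simp: F_def Ints_def)
    show ?thesis
      by (intro exI[of _ "\<lambda>f. \<lfloor>x f\<rfloor>"]) (simp add: floor floor_le_ceiling)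
  next
    case False
    have two_row: "2 \<le> card {f\<in>F. fst f = i}" if l: "i \<in> fst ` F" for i
    proof -
      obtain p where p: "(i, p) \<in> F" using l by (auto simp: image_iff)
      have "2 \<le> card {p\<in>P. x (i, p) \<notin> \<int>}"
        using p less.prems(1) fin by (intro two_nonintegral_terms[of _ _ p]) (auto simp: F_def)
      also have "\<dots> = card (Pair i ` {p\<in>P. x (i, p) \<notin> \<int>})"
        by (subst card_image) (auto simp: inj_on_def)
      also have "Pair i ` {p\<in>P. x (i, p) \<notin> \<int>} = {f\<in>F. fst f = i}"
        using p by (auto simp: F_def)
      finally show ?thesis .
    qed
    have two_col: "2 \<le> card {f\<in>F. snd f = p}" if l: "p \<in> snd ` F" for p
    proof -
      obtain i where i: "(i, p) \<in> F" using l by (auto simp: image_iff)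
      have "2 \<le> card {i\<in>I. x (i, p) \<notin> \<int>}"
        using i less.prems(2) fin by (intro two_nonintegral_terms[of _ _ i]) (auto simp: F_def)
      also have "\<dots> = card ((\<lambda>i. (i, p)) ` {i\<in>I. x (i, p) \<notin> \<int>})"
        by (subst card_image) (auto simp: inj_on_def)
      also have "(\<lambda>i. (i, p)) ` {i\<in>I. x (i, p) \<notin> \<int>} = {f\<in>F. snd f = p}"
        using i by (auto simp: F_def)
      finally show ?thesis .
    qed
    have "\<exists>z :: 'a \<times> 'b \<Rightarrow> real. (\<exists>f\<in>F. z f \<noteq> 0) \<and>
      (\<forall>i. (\<Sum>f\<in>{f\<in>F. fst f = i}. z f) = 0) \<and> (\<forall>p. (\<Sum>f\<in>{f\<in>F. snd f = p}. z f) = 0)"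
      by (rule matrix_null_direction[OF F(1) False two_row two_col])
    then obtain z :: "'a \<times> 'b \<Rightarrow> real" where z: "\<exists>f\<in>F. z f \<noteq> 0"
      and zr: "\<forall>i. (\<Sum>f\<in>{f\<in>F. fst f = i}. z f) = 0" and zc: "\<forall>p. (\<Sum>f\<in>{f\<in>F. snd f = p}. z f) = 0"
      by (elim exE conjE)
    obtain t where t: "\<exists>f\<in>F. x f + t * z f \<in> \<int>"
      "\<And>f. f \<in> F \<Longrightarrow> of_int \<lfloor>x f\<rfloor> \<le> x f + t * z f \<and> x f + t * z f \<le> of_int \<lceil>x f\<rceil>"
      using step_until_integral[OF F(1) _ z, of x] by (auto simp: F_def)
    define x' where "x' f = (if f \<in> F then x f + t * z f else x f)" for f
    \<comment> \<open>Nothing is known about \<open>z\<close> outside \<open>F\<close>, so it is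
      masked there; entries that are already integral stay fixed.\<close>
    have x'_alt: "x' f = x f + t * of_bool (f \<in> F) * z f" for f by (simp add: x'_def)
    have row: "(\<Sum>p\<in>P. x' (i, p)) = (\<Sum>p\<in>P. x (i, p))" if "i \<in> I" for i
    proof -
      have "(\<Sum>f\<in>{f\<in>F. fst f = i}. z f) = (\<Sum>p\<in>{p\<in>P. (i, p) \<in> F}. z (i, p))"
        using F(2) by (intro sum.reindex_bij_witness[of _ "Pair i" snd]) auto
      also have "\<dots> = (\<Sum>p\<in>P. of_bool ((i, p) \<in> F) * z (i, p))"
        unfolding sum.inter_filter[OF fin(2)] by (rule sum.cong) auto
      finally show ?thesis
        by (simp add: x'_alt sum.distrib zr[rule_format] mult.assoc flip: sum_distrib_left)
    qed
    have col: "(\<Sum>i\<in>I. x' (i, p)) = (\<Sum>i\<in>I. x (i, p))" if "p \<in> P" for p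
    proof -
      have "(\<Sum>f\<in>{f\<in>F. snd f = p}. z f) = (\<Sum>i\<in>{i\<in>I. (i, p) \<in> F}. z (i, p))"
        using F(2) by (intro sum.reindex_bij_witness[of _ "\<lambda>i. (i, p)" fst]) auto
      also have "\<dots> = (\<Sum>i\<in>I. of_bool ((i, p) \<in> F) * z (i, p))"
        unfolding sum.inter_filter[OF fin(1)] by (rule sum.cong) auto
      finally show ?thesis
        by (simp add: x'_alt sum.distrib zc[rule_format] mult.assoc flip: sum_distrib_left)
    qed
    have "{f \<in> I \<times> P. x' f \<notin> \<int>} \<subset> F"
      using t(1) F(2) by (auto simp: x'_def F_def)
    then have "card {f \<in> I \<times> P. x' f \<notin> \<int>} < card {f \<in> I \<times> P. x f \<notin> \<int>}"
      using F(1) unfolding F_def[symmetric] by (rule psubset_card_mono[rotated])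
    then have "\<exists>y :: 'a \<times> 'b \<Rightarrow> int.
      (\<forall>f\<in>I \<times> P. \<lfloor>x' f\<rfloor> \<le> y f \<and> y f \<le> \<lceil>x' f\<rceil>) \<and>
      (\<forall>i\<in>I. of_int (\<Sum>p\<in>P. y (i, p)) = (\<Sum>p\<in>P. x' (i, p))) \<and>
      (\<forall>p\<in>P. of_int (\<Sum>i\<in>I. y (i, p)) = (\<Sum>i\<in>I. x' (i, p)))"
      by (rule less.hyps) (simp_all only: row col less.prems)
    then obtain y :: "'a \<times> 'b \<Rightarrow> int" where
      y: "\<forall>f\<in>I \<times> P. \<lfloor>x' f\<rfloor> \<le> y f \<and> y f \<le> \<lceil>x' f\<rceil>"
      and yr: "\<forall>i\<in>I. of_int (\<Sum>p\<in>P. y (i, p)) = (\<Sum>p\<in>P. x' (i, p))"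
      and yc: "\<forall>p\<in>P. of_int (\<Sum>i\<in>I. y (i, p)) = (\<Sum>i\<in>I. x' (i, p))"
      by (elim exE conjE)
    \<comment> \<open>The floor and ceiling of \<open>x f\<close> are integers that bound
      \<open>x' f\<close>, so rounding \<open>x'\<close> cannot leave the bounds set by
      \<open>x\<close>.\<close>
    have "\<lfloor>x f\<rfloor> \<le> \<lfloor>x' f\<rfloor> \<and> \<lceil>x' f\<rceil> \<le> \<lceil>x f\<rceil>" for f
      using t(2)[of f] by (auto simp: x'_def le_floor_iff ceiling_le_iff)
    with y have "\<forall>f\<in>I \<times> P. \<lfloor>x f\<rfloor> \<le> y f \<and> y f \<le> \<lceil>x f\<rceil>"
      by (meson order_trans)
    with yr yc row col show ?thesis by (intro exI[of _ y]) simp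
  qed
qed

lemma matrix_rounding:
  fixes x :: "'a \<Rightarrow> 'b \<Rightarrow> real"
  assumes fin: "finite I" "finite P"
    and cols: "\<And>p. p \<in> P \<Longrightarrow> (\<Sum>i\<in>I. x i p) \<in> \<int>"
  obtains y :: "'a \<Rightarrow> 'b \<Rightarrow> int" where
    "\<And>i p. i \<in> I \<Longrightarrow> p \<in> P \<Longrightarrow> \<lfloor>x i p\<rfloor> \<le> y i p \<and> y i p \<le> \<lceil>x i p\<rceil>"
    "\<And>i. i \<in> I \<Longrightarrow> \<lfloor>\<Sum>p\<in>P. x i p\<rfloor> \<le> (\<Sum>p\<in>P. y i p) \<and> (\<Sum>p\<in>P. y i p) \<le> \<lceil>\<Sum>p\<in>P. x i p\<rceil>"
    "\<And>p. p \<in> P \<Longrightarrow> of_int (\<Sum>i\<in>I. y i p) = (\<Sum>i\<in>I. x i p)"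
proof -
  \<comment> \<open>An extra column makes all row sums zero; the bounds on its entries are the bounds on the row sums.\<close>
  define x' where "x' f = (case snd f of Some p \<Rightarrow> x (fst f) p | None \<Rightarrow> - (\<Sum>p\<in>P. x (fst f) p))" for f
  let ?P = "insert None (Some ` P)"
  have sum_P: "(\<Sum>q\<in>?P. g q) = g None + (\<Sum>p\<in>P. g (Some p))" for g :: "'b option \<Rightarrow> 'c::comm_monoid_add"
    using fin by (subst sum.insert) (auto simp: sum.reindex)
  have row: "(\<Sum>q\<in>?P. x' (i, q)) = 0" for i
    by (simp only: sum_P) (simp add: x'_def)
  have col: "(\<Sum>i\<in>I. x' (i, q)) \<in> \<int>" if "q \<in> ?P" for q
  proof (cases q)
    case None
    \<comment> \<open>The extra column sums to minus the grand total, which is a sum of integral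
      column sums.\<close>
    have "(\<Sum>i\<in>I. \<Sum>p\<in>P. x i p) \<in> \<int>"
      using cols by (subst sum.swap) (rule Ints_sum)
    then show ?thesis using None by (simp add: x'_def sum_negf)
  next
    case (Some p)
    then show ?thesis using cols that by (auto simp: x'_def)
  qed
  have "finite ?P" using fin by simp
  moreover have "(\<Sum>q\<in>?P. x' (i, q)) \<in> \<int>" for i by (simp only: row Ints_0)
  ultimately have "\<exists>y :: 'a \<times> 'b option \<Rightarrow> int.
    (\<forall>f\<in>I \<times> ?P. \<lfloor>x' f\<rfloor> \<le> y f \<and> y f \<le> \<lceil>x' f\<rceil>) \<and>
    (\<forall>i\<in>I. real_of_int (\<Sum>q\<in>?P. y (i, q)) = (\<Sum>q\<in>?P. x' (i, q))) \<and>
    (\<forall>q\<in>?P. of_int (\<Sum>i\<in>I. y (i, q)) = (\<Sum>i\<in>I. x' (i, q)))"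
    using col by (intro matrix_rounding_integral_sums fin)
  then obtain y :: "'a \<times> 'b option \<Rightarrow> int" where
    y: "\<forall>f\<in>I \<times> ?P. \<lfloor>x' f\<rfloor> \<le> y f \<and> y f \<le> \<lceil>x' f\<rceil>"
    and yr: "\<forall>i\<in>I. real_of_int (\<Sum>q\<in>?P. y (i, q)) = 0"
    and yc: "\<forall>q\<in>?P. of_int (\<Sum>i\<in>I. y (i, q)) = (\<Sum>i\<in>I. x' (i, q))"
    unfolding row by (elim exE conjE)
  show thesis
  proof
    fix i p assume "i \<in> I" "p \<in> P"
    then show "\<lfloor>x i p\<rfloor> \<le> y (i, Some p) \<and> y (i, Some p) \<le> \<lceil>x i p\<rceil>"
      using y[rule_format, of "(i, Some p)"] by (simp add: x'_def)
  next
    fix i assume i: "i \<in> I"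
    \<comment> \<open>Negation exchanges floor and ceiling, so the bounds on the extra entry become
      the bounds on the row sum.\<close>
    have "(\<Sum>p\<in>P. y (i, Some p)) = - y (i, None)"
      using yr[rule_format, OF i] unfolding sum_P by linarith
    then show "\<lfloor>\<Sum>p\<in>P. x i p\<rfloor> \<le> (\<Sum>p\<in>P. y (i, Some p)) \<and> (\<Sum>p\<in>P. y (i, Some p)) \<le> \<lceil>\<Sum>p\<in>P. x i p\<rceil>"
      using y[rule_format, of "(i, None)"] i by (auto simp: x'_def ceiling_def)
  next
    fix p assume "p \<in> P"
    then show "of_int (\<Sum>i\<in>I. y (i, Some p)) = (\<Sum>i\<in>I. x i p)"
      using yc[rule_format, of "Some p"] by (simp add: x'_def)
  qed
qed

section \<open>Attaching the vertices one by one\<close>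

text \<open>Here \<open>D\<close> hinges are left for \<open>N\<close> vertices and \<open>d\<close>
  of them go to the next vertex. Since \<open>d\<close> differs from \<open>D / N\<close> by less
  than 1 and the average lies between consecutive integers, \<open>d\<close> is one of these two
  integers, and the average over the other \<open>N - 1\<close> vertices stays between them.\<close>

lemma rounded_quotient_bounds:
  fixes D d N \<rho> :: int
  assumes N: "N > 0" and D: "N * (\<rho> - 1) \<le> D" "D \<le> N * \<rho>"
    and d: "\<lfloor>real_of_int D / real_of_int N\<rfloor> \<le> d" "d \<le> \<lceil>real_of_int D / real_of_int N\<rceil>"
  shows "\<rho> - 1 \<le> d" "d \<le> \<rho>" "(N - 1) * (\<rho> - 1) \<le> D - d" "D - d \<le> (N - 1) * \<rho>"
proof -
  have "real_of_int D / real_of_int N < real_of_int d + 1" using d(1) by linarith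
  then have "real_of_int D < real_of_int (N * (d + 1))" using N by (simp add: field_simps)
  then have 1: "D < N * (d + 1)" by linarith
  have "real_of_int d - 1 < real_of_int D / real_of_int N" using d(2) by linarith
  then have "real_of_int (N * (d - 1)) < real_of_int D" using N by (simp add: field_simps)
  then have 2: "N * (d - 1) < D" by linarith
  have "N * (\<rho> - 1) < N * (d + 1)" "N * (d - 1) < N * \<rho>" using 1 2 D by linarith+
  then show *: "\<rho> - 1 \<le> d" "d \<le> \<rho>" using N by simp_all
  then consider "d = \<rho>" | "d = \<rho> - 1" by linarith
  \<comment> \<open>The lower bound for \<open>d = \<rho>\<close> and the upper bound for
    \<open>d = \<rho> - 1\<close> would miss by one if only \<open>D\<close> were used; the strict
    inequalities \<open>2\<close> and \<open>1\<close> supply that one over the integers.\<close>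
  then have "(N - 1) * (\<rho> - 1) \<le> D - d \<and> D - d \<le> (N - 1) * \<rho>"
    using 1 2 D by cases (auto simp: algebra_simps)
  then show "(N - 1) * (\<rho> - 1) \<le> D - d" "D - d \<le> (N - 1) * \<rho>" by auto
qed

text \<open>
  The pair \<open>(j, S)\<close> describes an edge of size \<open>h j\<close> whose vertices among the first \<open>l\<close> are
  already known: they form \<open>S\<close>. There are \<open>slots lam h (n - l) (j, S)\<close> such edges.
\<close>

definition traces :: "nat \<Rightarrow> nat \<Rightarrow> (nat \<times> nat set) set" where
  "traces m l = {1..m} \<times> Pow {1..l}"

definition add_vertex :: "nat \<Rightarrow> nat \<times> nat set \<Rightarrow> nat \<times> nat set" where
  "add_vertex v p = (fst p, insert v (snd p))"

text \<open>Integer-valued, hence negative on overfull traces, so that every added vertex lowers it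
  by exactly 1.\<close>

definition gap :: "(nat \<Rightarrow> nat) \<Rightarrow> nat \<times> nat set \<Rightarrow> int" where
  "gap h p = int (h (fst p)) - int (card (snd p))"

text \<open>The guard handles overfull traces, where truncated subtraction would yield
  \<open>q choose 0 = 1\<close> instead of 0.\<close>

definition slots :: "(nat \<Rightarrow> nat) \<Rightarrow> (nat \<Rightarrow> nat) \<Rightarrow> nat \<Rightarrow> nat \<times> nat set \<Rightarrow> nat" where
  "slots lam h q p =
     (if card (snd p) \<le> h (fst p) then lam (fst p) * (q choose (h (fst p) - card (snd p))) else 0)"

section \<open>Counting edges by their traces\<close>

lemma finite_traces [simp]: "finite (traces m l)"
  by (simp add: traces_def)

lemma traces_Suc: "traces m (Suc l) = traces m l \<union> add_vertex (Suc l) ` traces m l"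
proof -
  have "add_vertex (Suc l) = map_prod id (insert (Suc l))"
    by (simp add: fun_eq_iff add_vertex_def)
  then have "add_vertex (Suc l) ` traces m l = {1..m} \<times> insert (Suc l) ` Pow {1..l}"
    by (simp add: traces_def map_prod_surj_on)
  moreover have "{1..Suc l} = insert (Suc l) {1..l}" by auto
  ultimately show ?thesis
    by (simp only: traces_def Pow_insert Sigma_Un_distrib2)
qed

lemma not_in_trace: "p \<in> traces m l \<Longrightarrow> Suc l \<notin> snd p"
  by (auto simp: traces_def)

lemma sum_traces_Suc:
  "(\<Sum>p\<in>traces m (Suc l). g p) = (\<Sum>p\<in>traces m l. g p + g (add_vertex (Suc l) p))"
  for g :: "nat \<times> nat set \<Rightarrow> 'a::comm_monoid_add"
proof -
  have "inj_on (add_vertex (Suc l)) (traces m l)"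
    by (intro inj_onI prod_eqI) (auto simp: add_vertex_def dest: not_in_trace insert_ident)
  moreover have "traces m l \<inter> add_vertex (Suc l) ` traces m l = {}"
    by (auto simp: add_vertex_def dest: not_in_trace)
  ultimately show ?thesis
    by (simp add: traces_Suc sum.union_disjoint sum.reindex sum.distrib)
qed

lemma card_add_vertex:
  assumes "p \<in> traces m l"
  shows "card (snd (add_vertex (Suc l) p)) = Suc (card (snd p))"
proof -
  have "finite (snd p)" using assms finite_subset[of "snd p" "{1..l}"] by (auto simp: traces_def)
  then show ?thesis using not_in_trace[OF assms] by (simp add: add_vertex_def)
qed

lemma gap_add_vertex:
  assumes "p \<in> traces m l"
  shows "gap h (add_vertex (Suc l) p) = gap h p - 1"
  by (simp add: gap_def card_add_vertex[OF assms]) (simp add: add_vertex_def)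

text \<open>The first identity is Pascal's rule: the edges with trace \<open>p\<close> either avoid
  or contain the new vertex. The second is the absorption identity for binomial coefficients; it
  shows that the fractions \<open>gap h p / Suc q\<close> of all these edges add up to an integer,
  the number of edges that must receive the vertex.\<close>

lemma slots_add_vertex:
  assumes "p \<in> traces m l"
  shows "slots lam h (Suc q) p = slots lam h q p + slots lam h q (add_vertex (Suc l) p)"
    and "int (slots lam h (Suc q) p) * gap h p = int (Suc q) * int (slots lam h q (add_vertex (Suc l) p))"
proof -
  have f: "fst (add_vertex (Suc l) p) = fst p" by (simp add: add_vertex_def)
  note c = card_add_vertex[OF assms]
  consider "h (fst p) < card (snd p)" | "h (fst p) = card (snd p)"
    | g where "h (fst p) = card (snd p) + Suc g"
    by (metis less_imp_Suc_add linorder_neqE_nat add_Suc_right)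
  then have "slots lam h (Suc q) p = slots lam h q p + slots lam h q (add_vertex (Suc l) p) \<and>
      int (slots lam h (Suc q) p) * gap h p = int (Suc q) * int (slots lam h q (add_vertex (Suc l) p))"
  proof cases
    case 3
    have "int (Suc g) * int (Suc q choose Suc g) = int (Suc q) * int (q choose g)"
      using Suc_times_binomial[of g q] by (metis of_nat_mult)
    then have "int (lam (fst p)) * (int (Suc g) * int (Suc q choose Suc g))
        = int (lam (fst p)) * (int (Suc q) * int (q choose g))" by simp
    with 3 show ?thesis by (simp add: slots_def gap_def f c algebra_simps)
  qed (simp_all add: slots_def gap_def f c)
  then show "slots lam h (Suc q) p = slots lam h q p + slots lam h q (add_vertex (Suc l) p)"
    and "int (slots lam h (Suc q) p) * gap h p = int (Suc q) * int (slots lam h q (add_vertex (Suc l) p))"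
    by blast+
qed

text \<open>These bounds put the fraction \<open>gap h p / q\<close> into [0, 1] wherever edges
  exist and \<open>q\<close> is positive.\<close>

lemma gap_bounds:
  assumes "slots lam h q p \<noteq> 0"
  shows "0 \<le> gap h p" "gap h p \<le> int q"
  using assms by (auto simp: slots_def gap_def split: if_splits)

text \<open>
  \<open>M i (j, S)\<close> is the number of edges of type \<open>j\<close> and trace \<open>S\<close> in the \<open>i\<close>-th factor. The last
  condition is about the hinges at the remaining \<open>n - l\<close> vertices.
\<close>

definition partial_factorization ::
    "nat \<Rightarrow> nat \<Rightarrow> nat \<Rightarrow> (nat \<Rightarrow> nat) \<Rightarrow> (nat \<Rightarrow> nat) \<Rightarrow> (nat \<Rightarrow> nat) \<Rightarrow> nat \<Rightarrow>
     (nat \<Rightarrow> nat \<times> nat set \<Rightarrow> int) \<Rightarrow> bool" where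
  "partial_factorization n k m r lam h l M \<longleftrightarrow>
     (\<forall>i\<in>{1..k}. \<forall>p\<in>traces m l. 0 \<le> M i p) \<and>
     (\<forall>p\<in>traces m l. (\<Sum>i\<in>{1..k}. M i p) = int (slots lam h (n - l) p)) \<and>
     (\<forall>i\<in>{1..k}. \<forall>v\<in>{1..l}. (\<Sum>p\<in>traces m l. of_bool (v \<in> snd p) * M i p) \<in> {int (r i) - 1..int (r i)}) \<and>
     (\<forall>i\<in>{1..k}. (\<Sum>p\<in>traces m l. M i p * gap h p) \<in> {int (n - l) * (int (r i) - 1)..int (n - l) * int (r i)})"

text \<open>Of the \<open>M i p\<close> edges in factor \<open>i\<close> with trace
  \<open>p\<close>, a rounded share \<open>y i p\<close> receives the vertex \<open>Suc l\<close>.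
  Preserved column sums give the edge counts for the new traces, and the bounds on row sums give the
  degree of the new vertex and the hinges left over.\<close>

lemma partial_factorization_Suc:
  assumes "partial_factorization n k m r lam h l M" and "l < n"
  shows "\<exists>M'. partial_factorization n k m r lam h (Suc l) M'"
proof -
  obtain q where q: "n - l = Suc q" "n - Suc l = q" using assms(2) by (cases "n - l") auto
  let ?N = "Suc q" and ?T = "traces m l" and ?e = "add_vertex (Suc l)"
  have nonneg: "0 \<le> M i p" if "i \<in> {1..k}" "p \<in> ?T" for i p
    using assms(1) that by (simp add: partial_factorization_def)
  have col: "(\<Sum>i\<in>{1..k}. M i p) = int (slots lam h ?N p)" if "p \<in> ?T" for p
    using assms(1) that q by (simp add: partial_factorization_def)
  have deg: "(\<Sum>p\<in>?T. of_bool (v \<in> snd p) * M i p) \<in> {int (r i) - 1..int (r i)}"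
    if "i \<in> {1..k}" "v \<in> {1..l}" for i v
    using assms(1) that unfolding partial_factorization_def by blast
  have "(\<Sum>p\<in>?T. M i p * gap h p) \<in> {int ?N * (int (r i) - 1)..int ?N * int (r i)}" if "i \<in> {1..k}" for i
    using assms(1) that unfolding partial_factorization_def q(1) by blast
  then have rest: "int ?N * (int (r i) - 1) \<le> (\<Sum>p\<in>?T. M i p * gap h p)"
      "(\<Sum>p\<in>?T. M i p * gap h p) \<le> int ?N * int (r i)" if "i \<in> {1..k}" for i
    using that unfolding atLeastAtMost_iff by blast+
  \<comment> \<open>The ideal share: an edge lacking \<open>gap h p\<close> of the
    \<open>Suc q\<close> remaining vertices takes each of them with equal weight.\<close>
  define x where "x i p = real_of_int (M i p * gap h p) / real_of_int (int ?N)" for i p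
  have x_col: "(\<Sum>i\<in>{1..k}. x i p) = real_of_int (int (slots lam h q (?e p)))" if p: "p \<in> ?T" for p
  proof -
    have "(\<Sum>i\<in>{1..k}. x i p) = real_of_int ((\<Sum>i\<in>{1..k}. M i p) * gap h p) / real_of_int (int ?N)"
      by (simp only: x_def sum_divide_distrib[symmetric] sum_distrib_right of_int_sum)
    also have "(\<Sum>i\<in>{1..k}. M i p) * gap h p = int ?N * int (slots lam h q (?e p))"
      unfolding col[OF p] using slots_add_vertex(2)[OF p] .
    finally show ?thesis by simp
  qed
  have x_row: "(\<Sum>p\<in>?T. x i p) = real_of_int (\<Sum>p\<in>?T. M i p * gap h p) / real_of_int (int ?N)" for i
    by (simp only: x_def sum_divide_distrib[symmetric] of_int_sum)
  \<comment> \<open>A nonzero \<open>M i p\<close> forces \<open>slots\<close> to be nonzero, so the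
    share is a genuine fraction of \<open>M i p\<close>.\<close>
  have x_bounds: "0 \<le> x i p \<and> x i p \<le> real_of_int (M i p)" if i: "i \<in> {1..k}" and p: "p \<in> ?T" for i p
  proof (cases "M i p = 0")
    case True
    then show ?thesis by (simp add: x_def)
  next
    case False
    have "M i p \<le> (\<Sum>i\<in>{1..k}. M i p)"
      using i nonneg p by (intro member_le_sum) auto
    then have "slots lam h ?N p \<noteq> 0" using col[OF p] False nonneg[OF i p] by linarith
    note gap = gap_bounds[OF this]
    have "0 \<le> M i p * gap h p" "M i p * gap h p \<le> M i p * int ?N"
      using nonneg[OF i p] gap by (auto intro: mult_left_mono)
    then have "0 \<le> real_of_int (M i p * gap h p)" "real_of_int (M i p * gap h p) \<le> real_of_int (M i p * int ?N)"
      by linarith+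
    then show ?thesis by (simp add: x_def field_simps del: of_nat_Suc)
  qed
  have "(\<Sum>i\<in>{1..k}. x i p) \<in> \<int>" if "p \<in> ?T" for p
    unfolding x_col[OF that] by (rule Ints_of_int)
  then obtain y :: "nat \<Rightarrow> nat \<times> nat set \<Rightarrow> int" where
    y: "\<And>i p. i \<in> {1..k} \<Longrightarrow> p \<in> ?T \<Longrightarrow> \<lfloor>x i p\<rfloor> \<le> y i p \<and> y i p \<le> \<lceil>x i p\<rceil>"
    and y_row: "\<And>i. i \<in> {1..k} \<Longrightarrow> \<lfloor>\<Sum>p\<in>?T. x i p\<rfloor> \<le> (\<Sum>p\<in>?T. y i p) \<and> (\<Sum>p\<in>?T. y i p) \<le> \<lceil>\<Sum>p\<in>?T. x i p\<rceil>"
    and y_col: "\<And>p. p \<in> ?T \<Longrightarrow> real_of_int (\<Sum>i\<in>{1..k}. y i p) = (\<Sum>i\<in>{1..k}. x i p)"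
    using matrix_rounding[of "{1..k}" ?T x] by (metis finite_atLeastAtMost finite_traces)
  \<comment> \<open>Both bounds on \<open>x i p\<close> are integers and therefore survive
    rounding.\<close>
  have y_bounds: "0 \<le> y i p \<and> y i p \<le> M i p" if "i \<in> {1..k}" "p \<in> ?T" for i p
    using y[OF that] x_bounds[OF that] by (metis ceiling_le_iff le_floor_iff of_int_0 order_trans)
  have y_col: "(\<Sum>i\<in>{1..k}. y i p) = int (slots lam h q (?e p))" if "p \<in> ?T" for p
    using y_col[OF that] unfolding x_col[OF that] of_int_eq_iff .
  \<comment> \<open>A trace containing \<open>Suc l\<close> arises only by adding it to an old
    trace; the edges not chosen keep their trace.\<close>
  define M' where "M' i p = (if Suc l \<in> snd p then y i (fst p, snd p - {Suc l}) else M i p - y i p)" for i p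
  have M'_old: "M' i p = M i p - y i p" if "p \<in> ?T" for i p
    using not_in_trace[OF that] by (simp add: M'_def)
  have M'_new: "M' i (?e p) = y i p" if "p \<in> ?T" for i p
    using not_in_trace[OF that] by (simp add: M'_def add_vertex_def)
  have "partial_factorization n k m r lam h (Suc l) M'"
    unfolding partial_factorization_def q(2)
  proof (intro conjI ballI)
    fix i p assume i: "i \<in> {1..k}" and "p \<in> traces m (Suc l)"
    then consider "p \<in> ?T" | p' where "p' \<in> ?T" "p = ?e p'" unfolding traces_Suc by blast
    then show "0 \<le> M' i p"
      by cases (simp_all add: M'_old M'_new y_bounds[OF i])
  next
    fix p assume "p \<in> traces m (Suc l)"
    then consider "p \<in> ?T" | p' where "p' \<in> ?T" "p = ?e p'" unfolding traces_Suc by blast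
    then show "(\<Sum>i\<in>{1..k}. M' i p) = int (slots lam h q p)"
    proof cases
      case 1
      then show ?thesis
        using col[OF 1] y_col[OF 1] by (simp add: M'_old sum_subtractf slots_add_vertex(1)[OF 1])
    next
      case 2
      then show ?thesis using y_col[OF 2(1)] by (simp add: M'_new)
    qed
  next
    fix i v assume i: "i \<in> {1..k}" and v: "v \<in> {1..Suc l}"
    have "(\<Sum>p\<in>traces m (Suc l). of_bool (v \<in> snd p) * M' i p)
        = (\<Sum>p\<in>?T. of_bool (v \<in> snd p) * (M i p - y i p) + of_bool (v \<in> snd (?e p)) * y i p)"
      unfolding sum_traces_Suc by (rule sum.cong) (simp_all add: M'_old M'_new)
    also have "\<dots> \<in> {int (r i) - 1..int (r i)}"
    proof (cases "v = Suc l")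
      case True
      \<comment> \<open>No old trace contains the new vertex, so its degree is the row sum of
        \<open>y\<close>.\<close>
      have "(\<Sum>p\<in>?T. of_bool (v \<in> snd p) * (M i p - y i p) + of_bool (v \<in> snd (?e p)) * y i p)
          = (\<Sum>p\<in>?T. y i p)"
        using True by (intro sum.cong) (auto simp: add_vertex_def dest: not_in_trace)
      then show ?thesis
        using rounded_quotient_bounds(1,2)[OF _ rest[OF i]] y_row[OF i] unfolding x_row by simp
    next
      case False
      \<comment> \<open>For an old vertex, splitting a trace class in two leaves the degree
        unchanged.\<close>
      have "(\<Sum>p\<in>?T. of_bool (v \<in> snd p) * (M i p - y i p) + of_bool (v \<in> snd (?e p)) * y i p)
          = (\<Sum>p\<in>?T. of_bool (v \<in> snd p) * M i p)"
        using False by (intro sum.cong) (auto simp: add_vertex_def)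
      then show ?thesis using deg[OF i, of v] False v by simp
    qed
    finally show "(\<Sum>p\<in>traces m (Suc l). of_bool (v \<in> snd p) * M' i p) \<in> {int (r i) - 1..int (r i)}" .
  next
    fix i assume i: "i \<in> {1..k}"
    \<comment> \<open>Each edge that receives the vertex lowers the total gap by 1.\<close>
    have "(\<Sum>p\<in>traces m (Suc l). M' i p * gap h p) = (\<Sum>p\<in>?T. M i p * gap h p - y i p)"
      unfolding sum_traces_Suc
      by (rule sum.cong) (simp_all add: M'_old M'_new gap_add_vertex algebra_simps)
    also have "\<dots> = (\<Sum>p\<in>?T. M i p * gap h p) - (\<Sum>p\<in>?T. y i p)" by (rule sum_subtractf)
    finally show "(\<Sum>p\<in>traces m (Suc l). M' i p * gap h p) \<in> {int q * (int (r i) - 1)..int q * int (r i)}"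
      using rounded_quotient_bounds(3,4)[OF _ rest[OF i]] y_row[OF i] unfolding x_row by simp
  qed
  then show ?thesis by blast
qed

lemma partial_factorization_exists:
  fixes A :: "nat \<Rightarrow> nat \<Rightarrow> nat"
  assumes "\<forall>i\<in>{1..k}. int n * (int (r i) - 1) \<le> int (\<Sum>j\<in>{1..m}. A i j * h j) \<and>
      (\<Sum>j\<in>{1..m}. A i j * h j) \<le> n * r i"
    and "\<forall>j\<in>{1..m}. (\<Sum>i\<in>{1..k}. A i j) = lam j * (n choose h j)"
    and "l \<le> n"
  shows "\<exists>M. partial_factorization n k m r lam h l M"
  using assms(3)
proof (induction l)
  case 0
  have T: "traces m 0 = (\<lambda>j. (j, {})) ` {1..m}" by (auto simp: traces_def)
  have "(\<Sum>p\<in>traces m 0. int (A i (fst p)) * gap h p) = int (\<Sum>j\<in>{1..m}. A i j * h j)" for i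
    unfolding T by (subst sum.reindex) (auto simp: inj_on_def gap_def)
  moreover have "int (\<Sum>j\<in>{1..m}. A i j * h j) \<le> int n * int (r i)" if "i \<in> {1..k}" for i
    using assms(1) that by (metis of_nat_le_iff of_nat_mult)
  \<comment> \<open>With no vertex attached, each type has only the empty trace, and the conditions
    on the counts become the row and column conditions on \<open>A\<close>.\<close>
  ultimately have "partial_factorization n k m r lam h 0 (\<lambda>i p. int (A i (fst p)))"
    using assms by (auto simp: partial_factorization_def T slots_def simp flip: of_nat_sum)
  then show ?case by blast
next
  case (Suc l)
  then show ?case using partial_factorization_Suc by force
qed

section \<open>Almost factorizations\<close>

text \<open>Blocks of the prescribed sizes are cut off \<open>C\<close> one after the other. This
  turns counts per factor into an assignment of parallel edges.\<close>

lemma exists_map_with_fibre_cards: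
  fixes a :: "'a \<Rightarrow> nat"
  assumes "finite I" "finite C" "(\<Sum>i\<in>I. a i) = card C"
  shows "\<exists>f. f ` C \<subseteq> I \<and> (\<forall>i\<in>I. card {c\<in>C. f c = i} = a i)"
  using assms
proof (induction I arbitrary: C rule: finite_induct)
  case (insert i I)
  then have "a i \<le> card C" by simp
  then obtain D where D: "D \<subseteq> C" "card D = a i" "finite D"
    by (rule obtain_subset_with_card_n)
  have "(\<Sum>i\<in>I. a i) = card (C - D)"
    using insert D by (simp add: card_Diff_subset)
  with insert obtain f where f: "f ` (C - D) \<subseteq> I" "\<And>j. j \<in> I \<Longrightarrow> card {c\<in>C - D. f c = j} = a j"
    by (metis finite_Diff)
  define g where "g c = (if c \<in> D then i else f c)" for c
  have "{c\<in>C. g c = i} = D" using D(1) f(1) insert.hyps(2) by (auto simp: g_def)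
  moreover have "{c\<in>C. g c = j} = {c\<in>C - D. f c = j}" if "j \<in> I" for j
    using that insert.hyps(2) by (auto simp: g_def)
  moreover have "g ` C \<subseteq> insert i I" using f(1) by (auto simp: g_def)
  ultimately show ?case using D(2) f(2) by (intro exI[of _ g]) auto
qed auto

lemma hdegree_spanning_sub_LK:
  assumes "F \<subseteq> LK_edges n m lam h"
  shows "hdegree (spanning_sub (LK n m lam h) F) v = card {e\<in>F. v \<in> fst (snd e)}"
proof -
  have "{x \<in> hinges (spanning_sub (LK n m lam h) F). hinge_vert (spanning_sub (LK n m lam h) F) x = v}
      = (\<lambda>e. (e, v)) ` {e\<in>F. v \<in> fst (snd e)}"
    using assms by (auto simp: spanning_sub_def LK_def)
  then show ?thesis
    by (simp add: hdegree_def card_image inj_on_def)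
qed

lemma is_factor_LK_iff:
  "is_factor (LK n m lam h) q r F \<longleftrightarrow> F \<subseteq> LK_edges n m lam h \<and>
     (\<forall>v\<in>{1..n}. q \<le> int (card {e\<in>F. v \<in> fst (snd e)}) \<and> int (card {e\<in>F. v \<in> fst (snd e)}) \<le> r)"
proof (cases "F \<subseteq> LK_edges n m lam h")
  case True
  then show ?thesis by (simp add: is_factor_def hdegree_spanning_sub_LK) (simp add: LK_def)
qed (simp add: is_factor_def LK_def)

lemma card_LK_edges_of_type:
  assumes "j \<in> {1..m}"
  shows "card {e\<in>LK_edges n m lam h. fst e = j} = lam j * (n choose h j)"
proof -
  have "{e\<in>LK_edges n m lam h. fst e = j} = {j} \<times> {S. S \<subseteq> {1..n} \<and> card S = h j} \<times> {1..lam j}"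
    using assms by (auto simp: LK_edges_def)
  then show ?thesis by (simp add: card_cartesian_product n_subsets)
qed

text \<open>Double counting of the hinges of \<open>F\<close>, by vertex and by edge type.\<close>

lemma sum_degrees_LK:
  assumes "F \<subseteq> LK_edges n m lam h"
  shows "(\<Sum>v\<in>{1..n}. card {e\<in>F. v \<in> fst (snd e)}) = (\<Sum>j\<in>{1..m}. card {e\<in>F. fst e = j} * h j)"
proof -
  have F: "finite F" using assms finite_LK_edges by (rule finite_subset)
  have size: "card {v\<in>{1..n}. v \<in> fst (snd e)} = h (fst e)" if "e \<in> F" for e
  proof -
    have "{v\<in>{1..n}. v \<in> fst (snd e)} = fst (snd e)" "card (fst (snd e)) = h (fst e)"
      using subsetD[OF assms that] by (auto simp: LK_edges_def)
    then show ?thesis by simp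
  qed
  have "(\<Sum>v\<in>{1..n}. card {e\<in>F. v \<in> fst (snd e)}) = (\<Sum>e\<in>F. card {v\<in>{1..n}. v \<in> fst (snd e)})"
    using F by (intro sum_multicount_gen[symmetric]) auto
  also have "\<dots> = (\<Sum>e\<in>F. h (fst e))" using size by (rule sum.cong[OF refl])
  also have "\<dots> = (\<Sum>j\<in>{1..m}. \<Sum>e\<in>{e\<in>F. fst e = j}. h (fst e))"
    using F assms by (intro sum.group[symmetric]) (auto simp: LK_edges_def)
  also have "\<dots> = (\<Sum>j\<in>{1..m}. card {e\<in>F. fst e = j} * h j)" by simp
  finally show ?thesis .
qed

text \<open>\<open>A i j\<close> counts the edges of type \<open>j\<close> in the
  \<open>i\<close>-th factor. Its row conditions are the degree bounds summed over the
  \<open>n\<close> vertices, and its column conditions count all edges of one type.\<close>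

lemma almost_factorization_type_matrix:
  assumes "almost_factorizable (LK n m lam h) k r"
  shows "\<exists>A :: nat \<Rightarrow> nat \<Rightarrow> nat.
    (\<forall>i\<in>{1..k}. int n * (int (r i) - 1) \<le> int (\<Sum>j\<in>{1..m}. A i j * h j) \<and>
                (\<Sum>j\<in>{1..m}. A i j * h j) \<le> n * r i) \<and>
    (\<forall>j\<in>{1..m}. (\<Sum>i\<in>{1..k}. A i j) = lam j * (n choose h j))"
proof -
  from assms obtain F where un: "(\<Union>i\<in>{1..k}. F i) = LK_edges n m lam h"
    and disj: "disjoint_family_on F {1..k}"
    and fac: "\<And>i. i \<in> {1..k} \<Longrightarrow> is_factor (LK n m lam h) (int (r i) - 1) (int (r i)) (F i)"
    unfolding almost_factorizable_def by (auto simp: LK_def)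
  define A where "A i j = card {e\<in>F i. fst e = j}" for i j
  have A: "int (\<Sum>j\<in>{1..m}. A i j * h j) = (\<Sum>v\<in>{1..n}. int (card {e\<in>F i. v \<in> fst (snd e)}))"
    if "i \<in> {1..k}" for i
    using sum_degrees_LK[of "F i" n m lam h] fac[OF that]
    by (simp add: A_def is_factor_LK_iff flip: of_nat_sum)
  have lower: "int n * (int (r i) - 1) \<le> int (\<Sum>j\<in>{1..m}. A i j * h j)" if "i \<in> {1..k}" for i
  proof -
    have "(\<Sum>v\<in>{1..n}. int (r i) - 1) \<le> (\<Sum>v\<in>{1..n}. int (card {e\<in>F i. v \<in> fst (snd e)}))"
      using fac[OF that] by (intro sum_mono) (simp add: is_factor_LK_iff)
    then show ?thesis unfolding A[OF that] by simp
  qed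
  have upper: "(\<Sum>j\<in>{1..m}. A i j * h j) \<le> n * r i" if "i \<in> {1..k}" for i
  proof -
    have "(\<Sum>v\<in>{1..n}. int (card {e\<in>F i. v \<in> fst (snd e)})) \<le> (\<Sum>v\<in>{1..n}. int (r i))"
      using fac[OF that] by (intro sum_mono) (simp add: is_factor_LK_iff)
    then have "int (\<Sum>j\<in>{1..m}. A i j * h j) \<le> int (n * r i)" unfolding A[OF that] by simp
    then show ?thesis by (simp only: of_nat_le_iff)
  qed
  have "(\<Sum>i\<in>{1..k}. A i j) = lam j * (n choose h j)" if "j \<in> {1..m}" for j
  proof -
    have "finite (F i)" if "i \<in> {1..k}" for i
      using fac[OF that] finite_subset[OF _ finite_LK_edges] by (auto simp: is_factor_LK_iff)
    then have "(\<Sum>i\<in>{1..k}. A i j) = card (\<Union>i\<in>{1..k}. {e\<in>F i. fst e = j})"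
      unfolding A_def using disj
      by (intro card_UN_disjoint[symmetric]) (auto simp: disjoint_family_on_def)
    also have "(\<Union>i\<in>{1..k}. {e\<in>F i. fst e = j}) = {e\<in>LK_edges n m lam h. fst e = j}"
      using un by blast
    finally show ?thesis using card_LK_edges_of_type[OF that] by simp
  qed
  with lower upper show ?thesis by (intro exI[of _ A]) blast
qed

text \<open>Summing the row conditions over all factors bounds the total number of hinges. By the
  column conditions and \<open>h * (n choose h) = n * ((n - 1) choose (h - 1))\<close> this total is
  \<open>n\<close> times the common vertex degree, and the positive factor \<open>n\<close>
  cancels.\<close>

lemma type_matrix_total:
  fixes A :: "nat \<Rightarrow> nat \<Rightarrow> nat"
  assumes n: "n \<ge> 1" and h: "h ` {1..m} \<subseteq> {1..n}"
    and rows: "\<forall>i\<in>{1..k}. int n * (int (r i) - 1) \<le> int (\<Sum>j\<in>{1..m}. A i j * h j) \<and>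
      (\<Sum>j\<in>{1..m}. A i j * h j) \<le> n * r i"
    and cols: "\<forall>j\<in>{1..m}. (\<Sum>i\<in>{1..k}. A i j) = lam j * (n choose h j)"
  shows "int (\<Sum>i\<in>{1..k}. r i) - int k \<le> int (\<Sum>j\<in>{1..m}. lam j * ((n - 1) choose (h j - 1)))"
    and "(\<Sum>j\<in>{1..m}. lam j * ((n - 1) choose (h j - 1))) \<le> (\<Sum>i\<in>{1..k}. r i)"
proof -
  let ?L = "\<Sum>j\<in>{1..m}. lam j * ((n - 1) choose (h j - 1))"
  have "(\<Sum>i\<in>{1..k}. \<Sum>j\<in>{1..m}. A i j * h j) = (\<Sum>j\<in>{1..m}. (\<Sum>i\<in>{1..k}. A i j) * h j)"
    by (subst sum.swap) (simp add: sum_distrib_right)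
  also have "\<dots> = (\<Sum>j\<in>{1..m}. n * (lam j * ((n - 1) choose (h j - 1))))"
  proof (rule sum.cong[OF refl])
    fix j assume j: "j \<in> {1..m}"
    then have "h j \<in> {1..n}" using h by blast
    then have "h j * (n choose h j) = n * ((n - 1) choose (h j - 1))"
      by (intro times_binomial_minus1_eq) simp
    then show "(\<Sum>i\<in>{1..k}. A i j) * h j = n * (lam j * ((n - 1) choose (h j - 1)))"
      using cols j by (simp add: algebra_simps)
  qed
  finally have total: "(\<Sum>i\<in>{1..k}. \<Sum>j\<in>{1..m}. A i j * h j) = n * ?L"
    by (simp add: sum_distrib_left)
  have "(\<Sum>i\<in>{1..k}. \<Sum>j\<in>{1..m}. A i j * h j) \<le> (\<Sum>i\<in>{1..k}. n * r i)"
    using rows by (intro sum_mono) blast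
  then have "n * ?L \<le> n * (\<Sum>i\<in>{1..k}. r i)" unfolding total by (simp add: sum_distrib_left)
  then show "?L \<le> (\<Sum>i\<in>{1..k}. r i)" using n by simp
  have "(\<Sum>i\<in>{1..k}. int n * (int (r i) - 1)) \<le> (\<Sum>i\<in>{1..k}. int (\<Sum>j\<in>{1..m}. A i j * h j))"
    using rows by (intro sum_mono) blast
  also have "\<dots> = int (n * ?L)" unfolding total[symmetric] by (rule of_nat_sum[symmetric])
  also have "(\<Sum>i\<in>{1..k}. int n * (int (r i) - 1)) = int n * (int (\<Sum>i\<in>{1..k}. r i) - int k)"
    by (simp add: sum_subtractf flip: sum_distrib_left)
  finally have "int n * (int (\<Sum>i\<in>{1..k}. r i) - int k) \<le> int n * int ?L" by simp
  then show "int (\<Sum>i\<in>{1..k}. r i) - int k \<le> int ?L" using n by (simp del: of_nat_sum)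
qed

text \<open>Once all \<open>n\<close> vertices are attached, the traces that still carry edges are
  the full vertex sets, and \<open>M i p\<close> prescribes how many of the parallel edges at
  \<open>p\<close> go to the \<open>i\<close>-th factor. Since parallel edges have the same
  vertices, any choice with these counts has the right degrees.\<close>

lemma almost_factorizable_of_partial_factorization:
  assumes M: "partial_factorization n k m r lam h n M"
  shows "almost_factorizable (LK n m lam h) k r"
proof -
  have nonneg: "0 \<le> M i p" if "i \<in> {1..k}" "p \<in> traces m n" for i p
    using M that by (simp add: partial_factorization_def)
  have col: "(\<Sum>i\<in>{1..k}. M i p) = int (slots lam h 0 p)" if "p \<in> traces m n" for p
    using M that by (simp add: partial_factorization_def)
  have deg: "(\<Sum>p\<in>traces m n. of_bool (v \<in> snd p) * M i p) \<in> {int (r i) - 1..int (r i)}"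
    if "i \<in> {1..k}" "v \<in> {1..n}" for i v
    using M that unfolding partial_factorization_def by blast
  define C where "C p = {c. (fst p, snd p, c) \<in> LK_edges n m lam h}" for p
  have C: "card (C p) = slots lam h 0 p" "finite (C p)" if "p \<in> traces m n" for p
  proof -
    \<comment> \<open>This matches \<open>slots\<close> at 0, because \<open>0 choose g\<close>
      vanishes unless \<open>g = 0\<close>.\<close>
    have "C p = (if card (snd p) = h (fst p) then {1..lam (fst p)} else {})"
      using that by (auto simp: C_def LK_edges_def traces_def)
    then show "card (C p) = slots lam h 0 p" "finite (C p)"
      by (auto simp: slots_def)
  qed
  have "\<exists>f. f ` C p \<subseteq> {1..k} \<and> (\<forall>i\<in>{1..k}. card {c\<in>C p. f c = i} = nat (M i p))"
    if p: "p \<in> traces m n" for p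
  proof (rule exists_map_with_fibre_cards)
    have "int (\<Sum>i\<in>{1..k}. nat (M i p)) = (\<Sum>i\<in>{1..k}. M i p)"
      unfolding of_nat_sum using nonneg[OF _ p] by (intro sum.cong) auto
    then show "(\<Sum>i\<in>{1..k}. nat (M i p)) = card (C p)"
      unfolding col[OF p] C(1)[OF p] by (simp only: of_nat_eq_iff)
  qed (simp_all add: C[OF p])
  then obtain f where f_range: "\<And>p. p \<in> traces m n \<Longrightarrow> f p ` C p \<subseteq> {1..k}"
    and f_card: "\<And>p i. p \<in> traces m n \<Longrightarrow> i \<in> {1..k} \<Longrightarrow> card {c\<in>C p. f p c = i} = nat (M i p)"
    by metis
  define F where "F i = {(j, S, c) \<in> LK_edges n m lam h. f (j, S) c = i}" for i
  have trace: "(j, S) \<in> traces m n \<and> c \<in> C (j, S)" if "(j, S, c) \<in> LK_edges n m lam h" for j S c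
    using that by (auto simp: LK_edges_def traces_def C_def)
  have "(\<Union>i\<in>{1..k}. F i) = LK_edges n m lam h"
  proof (intro equalityI subsetI)
    fix e assume e: "e \<in> LK_edges n m lam h"
    obtain j S c where [simp]: "e = (j, S, c)" by (cases e)
    have "f (j, S) c \<in> {1..k}" using trace[of j S c] f_range[of "(j, S)"] e by (simp add: image_subset_iff)
    then show "e \<in> (\<Union>i\<in>{1..k}. F i)" using e by (auto simp: F_def)
  qed (auto simp: F_def)
  moreover have "disjoint_family_on F {1..k}" by (auto simp: disjoint_family_on_def F_def)
  moreover have "is_factor (LK n m lam h) (int (r i) - 1) (int (r i)) (F i)" if i: "i \<in> {1..k}" for i
  proof -
    have "int (card {e\<in>F i. v \<in> fst (snd e)}) \<in> {int (r i) - 1..int (r i)}" if v: "v \<in> {1..n}" for v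
    proof -
      let ?T = "{p\<in>traces m n. v \<in> snd p}"
      \<comment> \<open>An edge of the factor at \<open>v\<close> amounts to a trace containing
        \<open>v\<close> and a copy number assigned to \<open>i\<close>.\<close>
      have "bij_betw (\<lambda>(p, c). (fst p, snd p, c)) (SIGMA p:?T. {c\<in>C p. f p c = i}) {e\<in>F i. v \<in> fst (snd e)}"
        by (rule bij_betw_byWitness[where f' = "\<lambda>(j, S, c). ((j, S), c)"])
          (auto simp: F_def C_def dest: trace)
      then have "card {e\<in>F i. v \<in> fst (snd e)} = card (SIGMA p:?T. {c\<in>C p. f p c = i})"
        by (rule bij_betw_same_card[symmetric])
      also have "\<dots> = (\<Sum>p\<in>?T. card {c\<in>C p. f p c = i})"
        using C(2) by (intro card_SigmaI) auto
      also have "\<dots> = (\<Sum>p\<in>?T. nat (M i p))"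
        using f_card i by (intro sum.cong) auto
      finally have "int (card {e\<in>F i. v \<in> fst (snd e)}) = (\<Sum>p\<in>?T. M i p)"
        using nonneg[OF i] by simp
      also have "\<dots> = (\<Sum>p\<in>traces m n. of_bool (v \<in> snd p) * M i p)"
        unfolding sum.inter_filter[OF finite_traces] by (rule sum.cong) auto
      finally show ?thesis using deg[OF i v] by simp
    qed
    then show ?thesis unfolding is_factor_LK_iff atLeastAtMost_iff by (auto simp: F_def)
  qed
  ultimately show ?thesis
    unfolding almost_factorizable_def by (intro exI[of _ F]) (simp add: LK_def)
qed

theorem theorem6p4:
  fixes n k m :: nat
    and r lam h :: "nat \<Rightarrow> nat"
  assumes "n \<ge> 1"
    and "h ` {1..m} \<subseteq> {1..n}"
    and "inj_on h {1..m}"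
  shows "almost_factorizable (LK n m lam h) k r \<longleftrightarrow>
    (int (\<Sum>i\<in>{1..k}. r i) - int k \<le> int (\<Sum>i\<in>{1..m}. lam i * ((n - 1) choose (h i - 1))) \<and>
     (\<Sum>i\<in>{1..m}. lam i * ((n - 1) choose (h i - 1))) \<le> (\<Sum>i\<in>{1..k}. r i) \<and>
     (\<exists>A :: nat \<Rightarrow> nat \<Rightarrow> nat.
        (\<forall>i\<in>{1..k}. int n * (int (r i) - 1) \<le> int (\<Sum>j\<in>{1..m}. A i j * h j) \<and>
                    (\<Sum>j\<in>{1..m}. A i j * h j) \<le> n * r i) \<and>
        (\<forall>j\<in>{1..m}. (\<Sum>i\<in>{1..k}. A i j) = lam j * (n choose h j))))"
proof (intro iffI conjI)
  assume "almost_factorizable (LK n m lam h) k r"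
  \<comment> \<open>One type matrix of the factorization serves all three conditions.\<close>
  note A = almost_factorization_type_matrix[OF this]
  then show "\<exists>A :: nat \<Rightarrow> nat \<Rightarrow> nat.
        (\<forall>i\<in>{1..k}. int n * (int (r i) - 1) \<le> int (\<Sum>j\<in>{1..m}. A i j * h j) \<and>
                    (\<Sum>j\<in>{1..m}. A i j * h j) \<le> n * r i) \<and>
        (\<forall>j\<in>{1..m}. (\<Sum>i\<in>{1..k}. A i j) = lam j * (n choose h j))" .
  from A show "int (\<Sum>i\<in>{1..k}. r i) - int k \<le> int (\<Sum>i\<in>{1..m}. lam i * ((n - 1) choose (h i - 1)))"
    by (elim exE conjE) (rule type_matrix_total(1)[OF assms(1,2)])
  from A show "(\<Sum>i\<in>{1..m}. lam i * ((n - 1) choose (h i - 1))) \<le> (\<Sum>i\<in>{1..k}. r i)"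
    by (elim exE conjE) (rule type_matrix_total(2)[OF assms(1,2)])
next
  assume "int (\<Sum>i\<in>{1..k}. r i) - int k \<le> int (\<Sum>i\<in>{1..m}. lam i * ((n - 1) choose (h i - 1))) \<and>
     (\<Sum>i\<in>{1..m}. lam i * ((n - 1) choose (h i - 1))) \<le> (\<Sum>i\<in>{1..k}. r i) \<and>
     (\<exists>A :: nat \<Rightarrow> nat \<Rightarrow> nat.
        (\<forall>i\<in>{1..k}. int n * (int (r i) - 1) \<le> int (\<Sum>j\<in>{1..m}. A i j * h j) \<and>
                    (\<Sum>j\<in>{1..m}. A i j * h j) \<le> n * r i) \<and>
        (\<forall>j\<in>{1..m}. (\<Sum>i\<in>{1..k}. A i j) = lam j * (n choose h j)))"
  then have "\<exists>M. partial_factorization n k m r lam h n M"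
    by (elim exE conjE) (rule partial_factorization_exists[OF _ _ order_refl])
  then show "almost_factorizable (LK n m lam h) k r"
    using almost_factorizable_of_partial_factorization by blast
qed

end
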